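(* Let $P$ be an $n\times n$ ($n\ge1$) permutation matrix with trace $0$ which is settled and Strang canonical, and let $w$ be its bandwidth. Then $P$ can be written as a product of fewer than $2w$ permutation matrices each of bandwidth at most $1$.
   Context: For an $n\times n$ permutation matrix $Q$, let $c_i(Q)$ be the column index of the $1$ in row $i$. The bandwidth of $Q$ is $\max_i|c_i(Q)-i|$; a matrix $M=(m_{ij})$ has bandwidth at most $1$ if $m_{ij}=0$ whenever $|i-j|>1$. Rows $i<j$ form an inverted pair if $c_i(Q)>c_j(Q)$, otherwise a contented pair. Row $i$ is positive if $c_i(Q)>i$, negative if $c_i(Q)<i$, neutral if $c_i(Q)=i$. Column $j$ is positive (negative, neutral) if the $1$ in column $j$ lies above (below, on) the diagonal. Sections: take the finest partition of $\{1,\dots,n\}$ into consecutive intervals each mapped onto itself by $i\mapsto c_i(Q)$; the corresponding diagonal blocks are the sections of $Q$. A section is upper-canonical if its positive rows are pairwise contented, lower-canonical if its negative rows are pairwise contented; $Q$ is Strang canonical if every section is both. A section is row-settled if all its positive rows lie above all its negative rows, and column-settled if all its negative columns lie to the left of all its positive columns. $Q$ is settled if either all its sections are row-settled or all its sections are column-settled. *)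

theory Defs
  imports Complex_Main "Jordan_Normal_Form.Matrix" "HOL-Library.Disjoint_Sets"
begin

text \<open>Rows and columns are numbered from 0, as everywhere in the matrix library. All notions below
  compare indices with each other only, so the shift from the numbering \<open>1, \<dots>, n\<close> is immaterial.\<close>

definition mat_trace :: "'a :: comm_monoid_add mat \<Rightarrow> 'a" where
  "mat_trace A = (\<Sum>i<dim_row A. A $$ (i, i))"

definition permutation_mat :: "nat \<Rightarrow> 'a :: zero_neq_one mat \<Rightarrow> bool" where
  "permutation_mat n Q \<longleftrightarrow>
     Q \<in> carrier_mat n n \<and>
     (\<forall>i<n. \<forall>j<n. Q $$ (i, j) = 0 \<or> Q $$ (i, j) = 1) \<and>
     (\<forall>i<n. \<exists>!j. j < n \<and> Q $$ (i, j) = 1) \<and>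
     (\<forall>j<n. \<exists>!i. i < n \<and> Q $$ (i, j) = 1)"

text \<open>The functions \<open>col_of Q\<close>, \<open>row_of Q\<close>, and everything built on them, are meaningful only for a
  permutation matrix \<open>Q\<close>.\<close>

definition col_of :: "'a :: zero_neq_one mat \<Rightarrow> nat \<Rightarrow> nat" where
  "col_of Q i = (THE j. j < dim_col Q \<and> Q $$ (i, j) = 1)"

definition row_of :: "'a :: zero_neq_one mat \<Rightarrow> nat \<Rightarrow> nat" where
  "row_of Q j = (THE i. i < dim_row Q \<and> Q $$ (i, j) = 1)"

definition bandwidth :: "'a :: zero_neq_one mat \<Rightarrow> nat" where
  "bandwidth Q = Max ((\<lambda>i. nat \<bar>int (col_of Q i) - int i\<bar>) ` {..<dim_row Q})"

definition bandwidth_at_most_1 :: "'a :: zero mat \<Rightarrow> bool" where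
  "bandwidth_at_most_1 M \<longleftrightarrow>
     (\<forall>i<dim_row M. \<forall>j<dim_col M. \<bar>int i - int j\<bar> > 1 \<longrightarrow> M $$ (i, j) = 0)"

definition inverted_pair :: "'a :: zero_neq_one mat \<Rightarrow> nat \<Rightarrow> nat \<Rightarrow> bool" where
  "inverted_pair Q i j \<longleftrightarrow> i < j \<and> col_of Q i > col_of Q j"

definition contented_pair :: "'a :: zero_neq_one mat \<Rightarrow> nat \<Rightarrow> nat \<Rightarrow> bool" where
  "contented_pair Q i j \<longleftrightarrow> i < j \<and> \<not> inverted_pair Q i j"

definition positive_row :: "'a :: zero_neq_one mat \<Rightarrow> nat \<Rightarrow> bool" where
  "positive_row Q i \<longleftrightarrow> col_of Q i > i"

definition negative_row :: "'a :: zero_neq_one mat \<Rightarrow> nat \<Rightarrow> bool" where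
  "negative_row Q i \<longleftrightarrow> col_of Q i < i"

text \<open>An entry in row \<open>i\<close> and column \<open>j\<close> lies above the diagonal iff \<open>i < j\<close>.\<close>

definition positive_col :: "'a :: zero_neq_one mat \<Rightarrow> nat \<Rightarrow> bool" where
  "positive_col Q j \<longleftrightarrow> row_of Q j < j"

definition negative_col :: "'a :: zero_neq_one mat \<Rightarrow> nat \<Rightarrow> bool" where
  "negative_col Q j \<longleftrightarrow> row_of Q j > j"

definition invariant_interval_partition :: "'a :: zero_neq_one mat \<Rightarrow> nat set set \<Rightarrow> bool" where
  "invariant_interval_partition Q S \<longleftrightarrow>
     partition_on {..<dim_row Q} S \<and>
     (\<forall>I\<in>S. (\<exists>a b. I = {a..<b}) \<and> col_of Q ` I = I)"

text \<open>A section is represented by its index set. Its rows and columns are numbered as in the whole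
  matrix; a diagonal block has the same offset for rows and columns, so signs and inversions of its
  rows and columns agree with those in \<open>Q\<close>.\<close>

definition sections :: "'a :: zero_neq_one mat \<Rightarrow> nat set set" where
  "sections Q = (THE S. invariant_interval_partition Q S \<and>
     (\<forall>T. invariant_interval_partition Q T \<longrightarrow> refines {..<dim_row Q} S T))"

definition upper_canonical :: "'a :: zero_neq_one mat \<Rightarrow> nat set \<Rightarrow> bool" where
  "upper_canonical Q I \<longleftrightarrow>
     (\<forall>i\<in>I. \<forall>j\<in>I. positive_row Q i \<and> positive_row Q j \<and> i < j \<longrightarrow> contented_pair Q i j)"

definition lower_canonical :: "'a :: zero_neq_one mat \<Rightarrow> nat set \<Rightarrow> bool" where
  "lower_canonical Q I \<longleftrightarrow>
     (\<forall>i\<in>I. \<forall>j\<in>I. negative_row Q i \<and> negative_row Q j \<and> i < j \<longrightarrow> contented_pair Q i j)"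

definition strang_canonical :: "'a :: zero_neq_one mat \<Rightarrow> bool" where
  "strang_canonical Q \<longleftrightarrow> (\<forall>I\<in>sections Q. upper_canonical Q I \<and> lower_canonical Q I)"

definition row_settled :: "'a :: zero_neq_one mat \<Rightarrow> nat set \<Rightarrow> bool" where
  "row_settled Q I \<longleftrightarrow> (\<forall>i\<in>I. \<forall>j\<in>I. positive_row Q i \<and> negative_row Q j \<longrightarrow> i < j)"

definition column_settled :: "'a :: zero_neq_one mat \<Rightarrow> nat set \<Rightarrow> bool" where
  "column_settled Q I \<longleftrightarrow> (\<forall>i\<in>I. \<forall>j\<in>I. negative_col Q i \<and> positive_col Q j \<longrightarrow> i < j)"

definition settled :: "'a :: zero_neq_one mat \<Rightarrow> bool" where
  "settled Q \<longleftrightarrow> (\<forall>I\<in>sections Q. row_settled Q I) \<or> (\<forall>I\<in>sections Q. column_settled Q I)"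

text \<open>The finest partition used in the definition of \<^const>\<open>sections\<close> exists and is unique.\<close>

lemma col_of_permutation_mat:
  assumes "permutation_mat n Q" "i < n"
  shows "col_of Q i < n" "Q $$ (i, col_of Q i) = 1"
proof -
  have n: "dim_col Q = n" using assms unfolding permutation_mat_def by auto
  have "\<exists>!j. j < dim_col Q \<and> Q $$ (i, j) = 1"
    using assms(2) conjunct1[OF conjunct2[OF conjunct2[OF assms(1)[unfolded permutation_mat_def]]]]
    unfolding n by simp
  from theI'[OF this] show "col_of Q i < n" "Q $$ (i, col_of Q i) = 1"
    unfolding col_of_def n by simp_all
qed

lemma inj_on_col_of:
  assumes "permutation_mat n Q"
  shows "inj_on (col_of Q) {..<n}"
proof (rule inj_onI)
  fix i j assume ij: "i \<in> {..<n}" "j \<in> {..<n}" "col_of Q i = col_of Q j"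
  then have "Q $$ (i, col_of Q i) = 1" "Q $$ (j, col_of Q i) = 1" "col_of Q i < n"
    using col_of_permutation_mat[OF assms, of i] col_of_permutation_mat[OF assms, of j] by auto
  moreover have "\<exists>!i. i < n \<and> Q $$ (i, col_of Q i') = 1" if "col_of Q i' < n" for i'
    using assms that unfolding permutation_mat_def by simp
  ultimately show "i = j" using ij(1,2) by blast
qed

lemma finite_nat_interval_if_convex:
  fixes X :: "nat set"
  assumes "finite X" "\<And>x y z. x \<in> X \<Longrightarrow> z \<in> X \<Longrightarrow> x \<le> y \<Longrightarrow> y \<le> z \<Longrightarrow> y \<in> X"
  shows "\<exists>a b. X = {a..<b}"
proof (cases "X = {}")
  case True
  then have "X = {0..<0}" by simp
  then show ?thesis by blast
next
  case False
  have "X = {Min X..<Suc (Max X)}"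
    using assms(2)[OF Min_in[OF assms(1) False] Max_in[OF assms(1) False]]
      Min_le[OF assms(1)] Max_ge[OF assms(1)] by (auto simp: less_Suc_eq_le)
  then show ?thesis by blast
qed

lemma sections_ex1:
  assumes "permutation_mat n Q"
  shows "\<exists>!S. invariant_interval_partition Q S \<and>
     (\<forall>T. invariant_interval_partition Q T \<longrightarrow> refines {..<dim_row Q} S T)"
proof (rule ex_ex1I)
  define PP where "PP = {T. invariant_interval_partition Q T}"
  have n: "dim_row Q = n" using assms unfolding permutation_mat_def by auto
  have part: "\<And>T. T \<in> PP \<Longrightarrow> partition_on {..<n} T"
    unfolding PP_def invariant_interval_partition_def n by auto
  have img: "col_of Q ` {..<n} = {..<n}"
    using col_of_permutation_mat(1)[OF assms] inj_on_col_of[OF assms]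
    by (intro endo_inj_surj) auto
  have ne: "PP \<noteq> {}"
  proof (cases "n = 0")
    case True
    then have "{} \<in> PP" unfolding PP_def invariant_interval_partition_def n partition_on_def by auto
    then show ?thesis by blast
  next
    case False
    have "{..<n} = {0..<n}" by auto
    then have "{{..<n}} \<in> PP" using False img
      unfolding PP_def invariant_interval_partition_def n partition_on_def by auto
    then show ?thesis by blast
  qed
  let ?S = "common_refinement PP"
  have pS: "partition_on {..<n} ?S" using partition_on_common_refinement[OF part ne] .
  have "(\<exists>a b. X = {a..<b}) \<and> col_of Q ` X = X" if X: "X \<in> ?S" for X
  proof -
    obtain f where f: "\<And>T. T \<in> PP \<Longrightarrow> f T \<in> T" and Xf: "X = \<Inter> (f ` PP)"
      using X unfolding common_refinement by auto
    have sub: "X \<subseteq> {..<n}" using X pS unfolding partition_on_def by auto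
    then have fin: "finite X" by (rule finite_subset) simp
    have ft: "(\<exists>a b. f T = {a..<b}) \<and> col_of Q ` f T = f T" if "T \<in> PP" for T
      using f[OF that] that unfolding PP_def invariant_interval_partition_def by auto
    have "\<exists>a b. X = {a..<b}"
    proof (rule finite_nat_interval_if_convex[OF fin])
      fix x y z assume h: "x \<in> X" "z \<in> X" "x \<le> y" "y \<le> z"
      have "y \<in> f T" if T: "T \<in> PP" for T
      proof -
        obtain a b where "f T = {a..<b}" using ft[OF T] by blast
        then show ?thesis using h T unfolding Xf by fastforce
      qed
      then show "y \<in> X" unfolding Xf by blast
    qed
    moreover have "col_of Q ` X = X"
    proof (rule endo_inj_surj[OF fin])
      show "col_of Q ` X \<subseteq> X" using ft unfolding Xf by blast
      show "inj_on (col_of Q) X" using inj_on_col_of[OF assms] sub by (rule inj_on_subset)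
    qed
    ultimately show ?thesis by blast
  qed
  then have "invariant_interval_partition Q ?S"
    using pS unfolding invariant_interval_partition_def n by blast
  moreover have "refines {..<dim_row Q} ?S T" if "invariant_interval_partition Q T" for T
    using refines_common_refinement[where P = T, OF part] that unfolding PP_def n by auto
  ultimately show "\<exists>S. invariant_interval_partition Q S \<and>
     (\<forall>T. invariant_interval_partition Q T \<longrightarrow> refines {..<dim_row Q} S T)" by blast
next
  fix S S'
  assume S: "invariant_interval_partition Q S \<and>
      (\<forall>T. invariant_interval_partition Q T \<longrightarrow> refines {..<dim_row Q} S T)"
    and S': "invariant_interval_partition Q S' \<and>
      (\<forall>T. invariant_interval_partition Q T \<longrightarrow> refines {..<dim_row Q} S' T)"
  have "refines {..<dim_row Q} S S'" using S S' by simp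
  moreover have "refines {..<dim_row Q} S' S" using S S' by simp
  ultimately show "S = S'" by (rule refines_asym)
qed

end

theory Submission
  imports Defs
begin

text \<open>
  A fixed-point-free row-settled canonical section on \<open>{a..<b}\<close> is a shuffle: rows \<open>a, \<dots>, m - 1\<close>
  move right and rows \<open>m, \<dots>, b - 1\<close> move left, each group keeping its order. Let the mover that
  starts in row \<open>r < m\<close> meet the one that starts in row \<open>s \<ge> m\<close> (if they have to cross) in round
  \<open>(m - 1 - r) + (s - m)\<close>; then the crossings of one round are disjoint adjacent transpositions.
  Column \<open>a\<close> is hit from a row \<open>\<ge> m\<close> and column \<open>b - 1\<close> from a row \<open>< m\<close>, so both groups have at
  most \<open>w\<close> members and \<open>2 w - 1\<close> rounds suffice. All sections are treated simultaneously, and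
  column-settled permutations are inverses of row-settled ones, so there the rounds are run backwards.
\<close>

section \<open>Schedules of movers, and the crossing schedule inside one section\<close>

text \<open>Here \<open>p t r\<close> is the position after \<open>t\<close> rounds of the mover
  that started in row \<open>r\<close>. Indexing by the starting row makes bijectivity of
  \<open>p t\<close> mean that no two movers collide, and the last clause says that no round shifts
  a mover by more than one place. The set \<open>A\<close> is kept general so that the same notion
  serves a single section and the whole index range.\<close>

definition unit_step_path :: "nat set \<Rightarrow> nat \<Rightarrow> (nat \<Rightarrow> nat) \<Rightarrow> (nat \<Rightarrow> nat \<Rightarrow> nat) \<Rightarrow> bool" where
  "unit_step_path A T c p \<longleftrightarrow>
     (\<forall>r\<in>A. p 0 r = r \<and> p T r = c r) \<and>
     (\<forall>t\<le>T. bij_betw (p t) A A) \<and>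
     (\<forall>t<T. \<forall>r\<in>A. p (Suc t) r \<le> Suc (p t r) \<and> p t r \<le> Suc (p (Suc t) r))"

text \<open>Turns values into ranks: for a row \<open>r\<close> of the interval,
  \<open>c r - a\<close> becomes the number of rows whose image is smaller than
  \<open>c r\<close>.\<close>

lemma card_preimage_lessThan:
  fixes c :: "nat \<Rightarrow> nat"
  assumes "bij_betw c {a..<b} {a..<b}" "v \<le> b"
  shows "card {x \<in> {a..<b}. c x < v} = v - a"
proof -
  have "inj_on c {x \<in> {a..<b}. c x < v}"
    using bij_betw_imp_inj_on[OF assms(1)] by (rule inj_on_subset) auto
  moreover have "c ` {x \<in> {a..<b}. c x < v} = {a..<v}"
  proof (intro equalityI subsetI)
    fix y assume y: "y \<in> {a..<v}"
    then have "y \<in> c ` {a..<b}" using bij_betw_imp_surj_on[OF assms(1)] assms(2) by simp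
    then show "y \<in> c ` {x \<in> {a..<b}. c x < v}" using y by auto
  next
    fix y assume "y \<in> c ` {x \<in> {a..<b}. c x < v}"
    then obtain x where "x \<in> {a..<b}" "y = c x" "c x < v" by blast
    then show "y \<in> {a..<v}" using bij_betwE[OF assms(1)] by fastforce
  qed
  ultimately show ?thesis by (metis card_image card_atLeastLessThan)
qed

text \<open>The scheduled meeting of \<open>r\<close> and \<open>s\<close> swaps the positions
  \<open>k = r + (s - m)\<close> and \<open>k + 1\<close>. Hence both targets must lie beyond this
  gap or neither. The reason is a count of ranks. If \<open>c s < c r\<close>, then rows
  \<open>a..r-1\<close> and \<open>m..s\<close> all have images below \<open>c r\<close>, so
  \<open>c r > k\<close>; every row with image below \<open>c s\<close> lies in
  \<open>a..r-1\<close> or \<open>m..s-1\<close>, so \<open>c s \<le> k\<close>. If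
  \<open>c r < c s\<close>, the same count with the roles exchanged gives
  \<open>c r \<le> k < c s\<close>.\<close>

lemma shuffle_cross_iff:
  fixes c :: "nat \<Rightarrow> nat"
  assumes bij: "bij_betw c {a..<b} {a..<b}"
    and mono1: "strict_mono_on {a..<m} c" and mono2: "strict_mono_on {m..<b} c"
    and rs: "a \<le> r" "r < m" "m \<le> s" "s < b"
  shows "r + (s - m) < c r \<longleftrightarrow> c s \<le> r + (s - m)"
proof -
  have rng: "c x \<in> {a..<b}" if "x \<in> {a..<b}" for x using bij that by (rule bij_betwE[rule_format])
  have cr: "c r \<in> {a..<b}" and cs: "c s \<in> {a..<b}" using rng[of r] rng[of s] rs by auto
  have cnt: "card {x \<in> {a..<b}. c x < c y} = c y - a" if "y \<in> {a..<b}" for y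
    using card_preimage_lessThan[OF bij, of "c y"] rng[OF that] by simp
  have cntr: "card {x \<in> {a..<b}. c x < c r} = c r - a" and cnts: "card {x \<in> {a..<b}. c x < c s} = c s - a"
    using cnt[of r] cnt[of s] rs by auto
  have lt1: "c x < c y \<longleftrightarrow> x < y" if "a \<le> x" "x < m" "a \<le> y" "y < m" for x y
    using strict_mono_on_less[OF mono1] that by auto
  have lt2: "c x < c y \<longleftrightarrow> x < y" if "m \<le> x" "x < b" "m \<le> y" "y < b" for x y
    using strict_mono_on_less[OF mono2] that by auto
  have un: "card ({a..<u} \<union> {m..<v}) = (u - a) + (v - m)" if "u \<le> m" for u v
    using that by (subst card_Un_disjoint) auto
  have "c r \<noteq> c s" using bij_betw_imp_inj_on[OF bij] rs by (auto dest: inj_onD)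
  then consider "c s < c r" | "c r < c s" by linarith
  then show ?thesis
  proof cases
    case 1
    have "{a..<r} \<union> {m..<Suc s} \<subseteq> {x \<in> {a..<b}. c x < c r}"
    proof
      fix x assume "x \<in> {a..<r} \<union> {m..<Suc s}"
      then consider "x \<in> {a..<r}" | "m \<le> x" "x \<le> s" by fastforce
      then show "x \<in> {x \<in> {a..<b}. c x < c r}"
      proof cases
        case 1
        then show ?thesis using lt1[of x r] rs by auto
      next
        case 2
        then have "c x \<le> c s" using lt2[of x s] rs by (cases "x = s") auto
        then show ?thesis using 2 rs \<open>c s < c r\<close> by auto
      qed
    qed
    then have A: "(r - a) + (Suc s - m) \<le> c r - a"
      using card_mono[OF _ \<open>{a..<r} \<union> {m..<Suc s} \<subseteq> _\<close>] un[of "r" "Suc s"] rs unfolding cntr by (simp del: Un_subset_iff)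
    have "{x \<in> {a..<b}. c x < c s} \<subseteq> {a..<r} \<union> {m..<s}"
    proof
      fix x assume x: "x \<in> {x \<in> {a..<b}. c x < c s}"
      show "x \<in> {a..<r} \<union> {m..<s}"
        using x lt1[of x r] lt2[of x s] rs \<open>c s < c r\<close> by (cases "x < m") auto
    qed
    then have B: "c s - a \<le> (r - a) + (s - m)"
      using card_mono[of "{a..<r} \<union> {m..<s}" "{x \<in> {a..<b}. c x < c s}"] un[of r s] rs unfolding cnts by simp
    show ?thesis using A B cr cs rs by auto
  next
    case 2
    have "{a..<Suc r} \<union> {m..<s} \<subseteq> {x \<in> {a..<b}. c x < c s}"
    proof
      fix x assume "x \<in> {a..<Suc r} \<union> {m..<s}"
      then consider "x \<in> {m..<s}" | "a \<le> x" "x \<le> r" by fastforce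
      then show "x \<in> {x \<in> {a..<b}. c x < c s}"
      proof cases
        case 1
        then show ?thesis using lt2[of x s] rs by auto
      next
        case 2
        then have "c x \<le> c r" using lt1[of x r] rs by (cases "x = r") auto
        then show ?thesis using 2 rs \<open>c r < c s\<close> by auto
      qed
    qed
    then have A: "(Suc r - a) + (s - m) \<le> c s - a"
      using card_mono[OF _ \<open>{a..<Suc r} \<union> {m..<s} \<subseteq> _\<close>] un[of "Suc r" "s"] rs unfolding cnts by (simp del: Un_subset_iff)
    have "{x \<in> {a..<b}. c x < c r} \<subseteq> {a..<r} \<union> {m..<s}"
    proof
      fix x assume x: "x \<in> {x \<in> {a..<b}. c x < c r}"
      show "x \<in> {a..<r} \<union> {m..<s}"
        using x lt1[of x r] lt2[of x s] rs \<open>c r < c s\<close> by (cases "x < m") auto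
    qed
    then have B: "c r - a \<le> (r - a) + (s - m)"
      using card_mono[of "{a..<r} \<union> {m..<s}" "{x \<in> {a..<b}. c x < c r}"] un[of r s] rs unfolding cntr by simp
    show ?thesis using A B cr cs rs by auto
  qed
qed

lemma shuffle_unit_step_path:
  fixes c :: "nat \<Rightarrow> nat"
  assumes bij: "bij_betw c {a..<b} {a..<b}"
    and right: "\<And>r. a \<le> r \<Longrightarrow> r < m \<Longrightarrow> r < c r"
    and left: "\<And>r. m \<le> r \<Longrightarrow> r < b \<Longrightarrow> c r < r"
    and mono1: "strict_mono_on {a..<m} c" and mono2: "strict_mono_on {m..<b} c"
    and m: "a \<le> m" "m \<le> b"
    and band: "\<And>r. r \<in> {a..<b} \<Longrightarrow> c r \<le> r + w \<and> r \<le> c r + w"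
  shows "\<exists>p. unit_step_path {a..<b} (2 * w - 1) c p"
proof -
  \<comment> \<open>Truncated subtraction makes a mover wait until its first round, which is
    \<open>m - 1 - r\<close> for \<open>r < m\<close> and \<open>r - m\<close> otherwise;
    \<open>min\<close> and \<open>max\<close> stop it at its target.\<close>
  define p where
    "p t r = (if r < m then min (c r) (r + (t + r + 1 - m)) else max (c r) (r - (t + m - r)))" for t r
  have rng: "c x \<in> {a..<b}" if "x \<in> {a..<b}" for x using bij that by (rule bij_betwE[rule_format])
  have sizes: "m \<le> a + w" "b \<le> m + w" if "a < b"
  proof -
    have "a \<in> c ` {a..<b}" "b - 1 \<in> c ` {a..<b}"
      using bij_betw_imp_surj_on[OF bij] that by auto
    then obtain r s where r: "r \<in> {a..<b}" "c r = a" and s: "s \<in> {a..<b}" "c s = b - 1"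
      by (metis imageE)
    show "m \<le> a + w" using r right[of r] band[of r] by (cases "r < m") auto
    show "b \<le> m + w" using s left[of s] band[of s] by (cases "s < m") auto
  qed
  have start: "p 0 r = r" if "r \<in> {a..<b}" for r
    using that right[of r] left[of r] unfolding p_def by auto
  \<comment> \<open>By \<open>sizes\<close> every mover sets off in round \<open>w - 1\<close> at
    the latest (rounds count from 0) and needs at most \<open>w\<close> moves, so all have arrived
    after \<open>(w - 1) + w\<close> rounds.\<close>
  have fin: "p (2 * w - 1) r = c r" if r: "r \<in> {a..<b}" for r
  proof -
    have "a < b" using r by auto
    note sz = sizes[OF this]
    show ?thesis
    proof (cases "r < m")
      case True
      then show ?thesis using right[of r] band[OF r] sz r unfolding p_def by auto
    next
      case False
      then show ?thesis using left[of r] band[OF r] sz r unfolding p_def by auto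
    qed
  qed
  have step: "p (Suc t) r \<le> Suc (p t r) \<and> p t r \<le> Suc (p (Suc t) r)" for t r
    unfolding p_def by auto
  \<comment> \<open>The position always lies between \<open>r\<close> and
    \<open>c r\<close>.\<close>
  have into: "p t r \<in> {a..<b}" if r: "r \<in> {a..<b}" for t r
    using r rng[OF r] right[of r] left[of r] unfolding p_def by (auto simp: min_def max_def)
  \<comment> \<open>Within one group the mover in front sets off first, and the targets are in the
    same order, so nobody catches up.\<close>
  have incr1: "p t r < p t s" if "a \<le> r" "r < s" "s < m" for t r s
  proof -
    have "c r < c s" using mono1 that by (auto simp: strict_mono_on_def)
    then show ?thesis using that unfolding p_def by auto
  qed
  have incr2: "p t r < p t s" if "m \<le> r" "r < s" "s < b" for t r s
  proof -
    have "c r < c s" using mono2 that by (auto simp: strict_mono_on_def)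
    then show ?thesis using that left[of s] unfolding p_def by auto
  qed
  have cross: "p t r \<noteq> p t s" if "a \<le> r" "r < m" "m \<le> s" "s < b" for t r s
  proof -
    have pr: "p t r = min (c r) (r + (t + r + 1 - m))" and ps: "p t s = max (c s) (s - (t + m - s))"
      using that unfolding p_def by auto
    note iff = shuffle_cross_iff[OF bij mono1 mono2 that]
    \<comment> \<open>The gap above \<open>r + (s - m)\<close> separates the two movers at all
      times. Case 1: they never cross it. Case 2: they will, but their meeting round
      \<open>s - 1 - r\<close> is not yet completed. Case 3: that round is over and they have
      changed sides.\<close>
    consider "c r \<le> r + (s - m)" | "r + (s - m) < c r" "t + r < s" | "r + (s - m) < c r" "s \<le> t + r"
      by linarith
    then show ?thesis
    proof cases
      case 1
      then have "p t r \<le> r + (s - m)" "r + (s - m) < p t s" using iff pr ps by linarith+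
      then show ?thesis by simp
    next
      case 2
      then have "p t r \<le> r + (s - m)" "r + (s - m) < s - (t + m - s)" using pr that by auto
      then show ?thesis using ps by linarith
    next
      case 3
      then have "r + (s - m) < p t r" "p t s \<le> r + (s - m)" using iff pr ps that by auto
      then show ?thesis by simp
    qed
  qed
  have inj: "inj_on (p t) {a..<b}" for t
  proof (rule linorder_inj_onI')
    fix r s assume h: "r \<in> {a..<b}" "s \<in> {a..<b}" "r < s"
    consider "s < m" | "r < m" "m \<le> s" | "m \<le> r" by linarith
    then show "p t r \<noteq> p t s"
    proof cases
      case 1 then show ?thesis using incr1[of r s t] h by auto
    next
      case 2 then show ?thesis using cross[of r s t] h by auto
    next
      case 3 then show ?thesis using incr2[of r s t] h by auto
    qed
  qed
  have "bij_betw (p t) {a..<b} {a..<b}" for t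
    using inj[of t] into[of _ t] endo_inj_surj[of "{a..<b}" "p t"] unfolding bij_betw_def by blast
  then have "unit_step_path {a..<b} (2 * w - 1) c p" using start fin step by (simp add: unit_step_path_def)
  then show ?thesis by (rule exI[of _ p])
qed

text \<open>Formulated for a map on an interval rather than a matrix, so that it applies to
  \<open>col_of\<close> and equally to \<open>row_of\<close>.\<close>

lemma row_settled_unit_step_path:
  fixes c :: "nat \<Rightarrow> nat"
  assumes bij: "bij_betw c {a..<b} {a..<b}"
    and nofix: "\<And>r. r \<in> {a..<b} \<Longrightarrow> c r \<noteq> r"
    and settled: "\<And>r s. r \<in> {a..<b} \<Longrightarrow> s \<in> {a..<b} \<Longrightarrow> r < c r \<Longrightarrow> c s < s \<Longrightarrow> r < s"
    and upper: "\<And>r s. r \<in> {a..<b} \<Longrightarrow> s \<in> {a..<b} \<Longrightarrow> r < s \<Longrightarrow> r < c r \<Longrightarrow> s < c s \<Longrightarrow> c r < c s"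
    and lower: "\<And>r s. r \<in> {a..<b} \<Longrightarrow> s \<in> {a..<b} \<Longrightarrow> r < s \<Longrightarrow> c r < r \<Longrightarrow> c s < s \<Longrightarrow> c r < c s"
    and band: "\<And>r. r \<in> {a..<b} \<Longrightarrow> c r \<le> r + w \<and> r \<le> c r + w"
  shows "\<exists>p. unit_step_path {a..<b} (2 * w - 1) c p"
proof (cases "a \<le> b")
  case False
  then show ?thesis by (auto simp: unit_step_path_def bij_betw_def)
next
  case True
  \<comment> \<open>The first row that moves left, or \<open>b\<close> if there is none.\<close>
  define m where "m = (LEAST r. a \<le> r \<and> (r = b \<or> c r < r))"
  have m: "a \<le> m \<and> (m = b \<or> c m < m)" unfolding m_def by (rule LeastI[of _ b]) (use True in auto)
  have mb: "m \<le> b" unfolding m_def by (rule Least_le) (use True in auto)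
  have right: "r < c r" if "a \<le> r" "r < m" for r
    using not_less_Least[OF that(2)[unfolded m_def]] nofix[of r] that mb by auto
  \<comment> \<open>A right-moving row at or below the left-moving row \<open>m\<close> would
    contradict settledness.\<close>
  have left: "c r < r" if "m \<le> r" "r < b" for r
    using settled[of r m] nofix[of r] that m by fastforce
  show ?thesis
  proof (rule shuffle_unit_step_path[OF bij right left])
    show "strict_mono_on {a..<m} c" using upper right mb by (auto simp: strict_mono_on_def)
    show "strict_mono_on {m..<b} c" using lower left m by (auto simp: strict_mono_on_def)
  qed (use m mb band in auto)
qed

section \<open>Combining paths over blocks and reversing them\<close>

text \<open>Movers never leave their block, so all blocks can use the same \<open>T\<close> rounds:
  the numbers of rounds do not add up.\<close>

lemma unit_step_path_partition:
  assumes part: "partition_on A S"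
    and ex: "\<And>I. I \<in> S \<Longrightarrow> \<exists>p. unit_step_path I T c p"
  shows "\<exists>p. unit_step_path A T c p"
proof -
  obtain q where q: "\<And>I. I \<in> S \<Longrightarrow> unit_step_path I T c (q I)" using ex by metis
  have blk: "\<exists>I\<in>S. r \<in> I" if "r \<in> A" for r using part that by (auto simp: partition_on_def)
  have uniq: "I = J" if "I \<in> S" "J \<in> S" "r \<in> I" "r \<in> J" for I J r
    using part that by (auto simp: partition_on_def disjoint_def)
  \<comment> \<open>For \<open>r\<close> in \<open>A\<close> the choice is forced, since exactly one
    block contains \<open>r\<close>.\<close>
  define p where "p t r = q (SOME I. I \<in> S \<and> r \<in> I) t r" for t r
  have p: "p t r = q I t r" if "I \<in> S" "r \<in> I" for I t r
  proof -
    have "(SOME I. I \<in> S \<and> r \<in> I) = I"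
      by (rule some_equality) (use that uniq[OF _ that(1) _ that(2)] in blast)+
    then show ?thesis by (simp add: p_def)
  qed
  have sub: "I \<subseteq> A" if "I \<in> S" for I using part that by (auto simp: partition_on_def)
  have bI: "bij_betw (p t) I I" if "I \<in> S" "t \<le> T" for I t
    using q[OF that(1)] that(2) bij_betw_cong[of I "p t" "q I t" I] p[OF that(1)]
    unfolding unit_step_path_def by simp
  have "bij_betw (p t) A A" if t: "t \<le> T" for t
  proof (rule bij_betw_imageI)
    show "p t ` A = A"
    proof -
      have "p t ` I = I" if "I \<in> S" for I using bI[OF that t] by (rule bij_betw_imp_surj_on)
      then have "p t ` \<Union>S = \<Union>S" by (simp add: image_Union)
      then show ?thesis using part by (simp add: partition_on_def)
    qed
    show "inj_on (p t) A"
    proof (rule inj_onI)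
      fix r s assume h: "r \<in> A" "s \<in> A" "p t r = p t s"
      obtain I J where IJ: "I \<in> S" "r \<in> I" "J \<in> S" "s \<in> J" using blk h by blast
      have "p t r \<in> I" "p t s \<in> J" using bI IJ t by (blast dest: bij_betwE)+
      then have "I = J" using uniq[of I J "p t r"] IJ h by simp
      then show "r = s" using bI[OF IJ(1) t] IJ h by (meson bij_betw_imp_inj_on inj_onD)
    qed
  qed
  moreover have "p 0 r = r \<and> p T r = c r" if r: "r \<in> A" for r
  proof -
    obtain I where "I \<in> S" "r \<in> I" using blk[OF r] by blast
    then show ?thesis using q[of I] p[of I r] unfolding unit_step_path_def by simp
  qed
  moreover have "p (Suc t) r \<le> Suc (p t r) \<and> p t r \<le> Suc (p (Suc t) r)" if t: "t < T" and r: "r \<in> A" for t r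
  proof -
    obtain I where "I \<in> S" "r \<in> I" using blk[OF r] by blast
    then show ?thesis using q[of I] p[of I r] t unfolding unit_step_path_def by simp
  qed
  ultimately show ?thesis unfolding unit_step_path_def by blast
qed

text \<open>Time is reversed. The mover now starting in \<open>r\<close> is the one that formerly
  started in \<open>c r\<close>, because that one ended in \<open>d (c r) = r\<close>.\<close>

lemma unit_step_path_inverse:
  assumes p: "unit_step_path A T d p"
    and bij: "bij_betw c A A" and inv: "\<And>r. r \<in> A \<Longrightarrow> d (c r) = r"
  shows "unit_step_path A T c (\<lambda>t r. p (T - t) (c r))"
proof -
  have cA: "c r \<in> A" if "r \<in> A" for r using bij that by (blast dest: bij_betwE)
  have "bij_betw (\<lambda>r. p (T - t) (c r)) A A" if "t \<le> T" for t
    using bij_betw_trans[OF bij, of "p (T - t)" A] p unfolding unit_step_path_def comp_def by simp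
  moreover have "p (T - Suc t) (c r) \<le> Suc (p (T - t) (c r)) \<and> p (T - t) (c r) \<le> Suc (p (T - Suc t) (c r))"
    if "t < T" "r \<in> A" for t r
  proof -
    have "T - t = Suc (T - Suc t)" using that by simp
    then show ?thesis using p cA[OF that(2)] that unfolding unit_step_path_def by simp
  qed
  ultimately show ?thesis using p cA inv unfolding unit_step_path_def by simp
qed

section \<open>From unit-step paths to products of matrices\<close>

definition perm_mat :: "nat \<Rightarrow> (nat \<Rightarrow> nat) \<Rightarrow> real mat" where
  "perm_mat n f = mat n n (\<lambda>(i, j). if f i = j then 1 else 0)"

lemma perm_mat_carrier [simp]: "perm_mat n f \<in> carrier_mat n n"
  by (simp add: perm_mat_def)

lemma perm_mat_cong: "(\<And>i. i < n \<Longrightarrow> f i = g i) \<Longrightarrow> perm_mat n f = perm_mat n g"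
  by (auto simp: perm_mat_def)

lemma perm_mat_id: "(\<And>i. i < n \<Longrightarrow> f i = i) \<Longrightarrow> perm_mat n f = 1\<^sub>m n"
  by (auto simp: perm_mat_def)

text \<open>Only the summand \<open>k = f i\<close> survives in row \<open>i\<close>. The left
  factor acts first, so a product lists the rounds in chronological order.\<close>

lemma perm_mat_mult:
  assumes "\<And>i. i < n \<Longrightarrow> f i < n"
  shows "perm_mat n f * perm_mat n g = perm_mat n (\<lambda>i. g (f i))"
proof (rule eq_matI)
  fix i j assume "i < dim_row (perm_mat n (\<lambda>i. g (f i)))" "j < dim_col (perm_mat n (\<lambda>i. g (f i)))"
  then have ij: "i < n" "j < n" by (auto simp: perm_mat_def)
  have "(perm_mat n f * perm_mat n g) $$ (i, j)
      = (\<Sum>k = 0..<n. (if f i = k then 1 else 0) * (if g k = j then 1 else 0))"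
    using ij by (simp add: perm_mat_def scalar_prod_def)
  also have "\<dots> = (\<Sum>k = 0..<n. if k = f i then (if g (f i) = j then 1 else 0) else 0)"
    by (rule sum.cong) auto
  also have "\<dots> = (if g (f i) = j then 1 else 0)" using assms[OF ij(1)] by simp
  finally show "(perm_mat n f * perm_mat n g) $$ (i, j) = perm_mat n (\<lambda>i. g (f i)) $$ (i, j)"
    using ij by (simp add: perm_mat_def)
qed (auto simp: perm_mat_def)

lemma permutation_mat_perm_mat:
  assumes bij: "bij_betw f {..<n} {..<n}"
  shows "permutation_mat n (perm_mat n f)"
proof -
  have lt: "f i < n" if "i < n" for i using bij that by (auto dest: bij_betwE)
  have ex: "\<exists>!i. i < n \<and> f i = j" if "j < n" for j
  proof -
    have "j \<in> f ` {..<n}" using bij_betw_imp_surj_on[OF bij] that by simp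
    then show ?thesis using bij_betw_imp_inj_on[OF bij] unfolding inj_on_def by blast
  qed
  have "(\<exists>!j. j < n \<and> perm_mat n f $$ (i, j) = 1)" if "i < n" for i
    by (rule ex1I[of _ "f i"]) (use lt[OF that] that in \<open>auto simp: perm_mat_def split: if_splits\<close>)
  moreover have "(\<exists>!i. i < n \<and> perm_mat n f $$ (i, j) = 1)" if "j < n" for j
  proof -
    have "(i < n \<and> perm_mat n f $$ (i, j) = 1) \<longleftrightarrow> (i < n \<and> f i = j)" for i
      using that by (auto simp: perm_mat_def split: if_splits)
    then show ?thesis using ex[OF that] by simp
  qed
  ultimately show ?thesis unfolding permutation_mat_def by (auto simp: perm_mat_def)
qed

lemma foldr_mult_carrier:
  assumes "\<And>M. M \<in> set Ms \<Longrightarrow> M \<in> carrier_mat n n"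
  shows "foldr (*) Ms (1\<^sub>m n :: 'a :: semiring_1 mat) \<in> carrier_mat n n"
  using assms by (induction Ms) (auto intro: mult_carrier_mat)

text \<open>One factor per round: round \<open>t\<close> permutes positions by
  \<open>p (Suc t)\<close> after the inverse of \<open>p t\<close>, and these permutations
  telescope.\<close>

lemma unit_step_path_factorization:
  assumes path: "unit_step_path {..<n} T c p"
  shows "\<exists>Ms :: real mat list. length Ms = T \<and>
           (\<forall>M\<in>set Ms. permutation_mat n M \<and> bandwidth_at_most_1 M) \<and>
           perm_mat n c = foldr (*) Ms (1\<^sub>m n)"
proof -
  \<comment> \<open>\<open>inv_into\<close> finds the mover that occupies position \<open>i\<close>
    at time \<open>t\<close>; \<open>p (Suc t)\<close> tells where it goes.\<close>
  define g where "g t = (\<lambda>i. p (Suc t) (inv_into {..<n} (p t) i))" for t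
  have bij: "bij_betw (p t) {..<n} {..<n}" if "t \<le> T" for t
    using path that unfolding unit_step_path_def by blast
  have lt: "p t i < n" if "t \<le> T" "i < n" for t i using bij[OF that(1)] that(2) by (auto dest: bij_betwE)
  have bg: "bij_betw (g t) {..<n} {..<n}" if "t < T" for t
    using bij_betw_trans[OF bij_betw_inv_into[OF bij[of t]] bij[of "Suc t"]] that
    unfolding g_def comp_def by simp
  have gp: "g t (p t i) = p (Suc t) i" if "t < T" "i < n" for t i
    using bij_betw_inv_into_left[OF bij[of t]] that unfolding g_def by simp
  have near: "bandwidth_at_most_1 (perm_mat n (g t))" if t: "t < T" for t
  proof -
    have "\<bar>int i - int (g t i)\<bar> \<le> 1" if "i < n" for i
    proof -
      have "i \<in> p t ` {..<n}" using bij_betw_imp_surj_on[OF bij[of t]] t that by simp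
      then obtain r where r: "r < n" "i = p t r" by blast
      have "p (Suc t) r \<le> Suc (p t r) \<and> p t r \<le> Suc (p (Suc t) r)"
        using path t r(1) unfolding unit_step_path_def by simp
      then show ?thesis unfolding r(2) gp[OF t r(1)] by linarith
    qed
    then have "f \<noteq> j" if "i < n" "f = g t i" "1 < \<bar>int i - int j\<bar>" for i j f using that by fastforce
    then show ?thesis unfolding bandwidth_at_most_1_def by (simp add: perm_mat_def)
  qed
  \<comment> \<open>Downward induction on \<open>s\<close> peels off the head of
    \<open>[s..<T]\<close>, as \<open>foldr\<close> does. At \<open>s = 0\<close> the left factor is
    the identity.\<close>
  have prod: "perm_mat n (p s) * foldr (*) (map (\<lambda>t. perm_mat n (g t)) [s..<T]) (1\<^sub>m n) = perm_mat n (p T)"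
    if "s \<le> T" for s using that
  proof (induction s rule: inc_induct)
    case base
    then show ?case using right_mult_one_mat[OF perm_mat_carrier] by simp
  next
    case (step s)
    let ?R = "foldr (*) (map (\<lambda>t. perm_mat n (g t)) [Suc s..<T]) (1\<^sub>m n)"
    have R: "?R \<in> carrier_mat n n" by (rule foldr_mult_carrier) auto
    have "perm_mat n (p s) * perm_mat n (g s) = perm_mat n (p (Suc s))"
      using perm_mat_mult[of n "p s" "g s"] lt[of s] step gp[of s]
        perm_mat_cong[of n "\<lambda>i. g s (p s i)" "p (Suc s)"] by simp
    then have "perm_mat n (p s) * (perm_mat n (g s) * ?R) = perm_mat n (p (Suc s)) * ?R"
      using assoc_mult_mat[OF perm_mat_carrier perm_mat_carrier R] by metis
    then show ?case using step by (simp add: upt_conv_Cons)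
  qed
  let ?Ms = "map (\<lambda>t. perm_mat n (g t)) [0..<T]"
  have R: "foldr (*) ?Ms (1\<^sub>m n) \<in> carrier_mat n n" by (rule foldr_mult_carrier) auto
  have "perm_mat n (p 0) = 1\<^sub>m n" using path unfolding unit_step_path_def by (intro perm_mat_id) auto
  moreover have "perm_mat n (p T) = perm_mat n c"
    using path unfolding unit_step_path_def by (intro perm_mat_cong) auto
  ultimately have "perm_mat n c = foldr (*) ?Ms (1\<^sub>m n)" using prod[of 0] left_mult_one_mat[OF R] by simp
  then show ?thesis using permutation_mat_perm_mat[OF bg] near
    by (intro exI[of _ ?Ms]) auto
qed

section \<open>Reading permutation, sections, fixed points and bandwidth off the matrix\<close>

lemma sections_invariant_interval_partition:
  "permutation_mat n Q \<Longrightarrow> invariant_interval_partition Q (sections Q)"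
  using theI'[OF sections_ex1] unfolding sections_def by blast

lemma bij_betw_col_of:
  assumes "permutation_mat n Q"
  shows "bij_betw (col_of Q) {..<n} {..<n}"
  using inj_on_col_of[OF assms] col_of_permutation_mat(1)[OF assms] endo_inj_surj[of "{..<n}" "col_of Q"]
  by (auto simp: bij_betw_def)

lemma row_of_col_of:
  assumes Q: "permutation_mat n Q" and i: "i < n"
  shows "row_of Q (col_of Q i) = i"
proof -
  have n: "dim_row Q = n" using Q unfolding permutation_mat_def by auto
  note c = col_of_permutation_mat[OF Q i]
  have "\<exists>!k. k < n \<and> Q $$ (k, col_of Q i) = 1" using Q c(1) unfolding permutation_mat_def by simp
  then show ?thesis using c i unfolding row_of_def n by (intro the1_equality) auto
qed

lemma perm_mat_col_of:
  assumes Q: "permutation_mat n (Q :: real mat)"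
  shows "perm_mat n (col_of Q) = Q"
proof (rule eq_matI)
  have car: "Q \<in> carrier_mat n n" using Q unfolding permutation_mat_def by auto
  fix i j assume "i < dim_row Q" "j < dim_col Q"
  then have ij: "i < n" "j < n" using car by auto
  have "\<exists>!j. j < n \<and> Q $$ (i, j) = 1" using Q ij unfolding permutation_mat_def by simp
  then have "Q $$ (i, j) = 1 \<longleftrightarrow> col_of Q i = j" using col_of_permutation_mat[OF Q ij(1)] ij by metis
  moreover have "Q $$ (i, j) = 0 \<or> Q $$ (i, j) = 1" using Q ij unfolding permutation_mat_def by simp
  ultimately show "perm_mat n (col_of Q) $$ (i, j) = Q $$ (i, j)" using ij by (auto simp: perm_mat_def)
qed (use Q in \<open>auto simp: perm_mat_def permutation_mat_def\<close>)

text \<open>The diagonal entries are 0 or 1, so a vanishing trace forces each of them to be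
  0.\<close>

lemma col_of_neq_if_trace_0:
  assumes Q: "permutation_mat n (Q :: real mat)" and tr: "mat_trace Q = 0" and i: "i < n"
  shows "col_of Q i \<noteq> i"
proof
  assume h: "col_of Q i = i"
  have n: "dim_row Q = n" using Q unfolding permutation_mat_def by auto
  have "0 \<le> Q $$ (k, k)" if "k < n" for k
  proof -
    have "Q $$ (k, k) = 0 \<or> Q $$ (k, k) = 1" using Q that unfolding permutation_mat_def by simp
    then show ?thesis by auto
  qed
  then have "\<forall>k\<in>{..<n}. Q $$ (k, k) = 0"
    using tr sum_nonneg_eq_0_iff[of "{..<n}" "\<lambda>k. Q $$ (k, k)"] unfolding mat_trace_def n by simp
  then have "Q $$ (i, i) = 0" using i by simp
  then show False using col_of_permutation_mat(2)[OF Q i] h by simp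
qed

lemma col_of_bandwidth:
  assumes "i < dim_row Q"
  shows "col_of Q i \<le> i + bandwidth Q \<and> i \<le> col_of Q i + bandwidth Q"
proof -
  have "nat \<bar>int (col_of Q i) - int i\<bar> \<le> bandwidth Q"
    unfolding bandwidth_def using assms by (intro Max_ge) auto
  then show ?thesis by linarith
qed

theorem theorem2p12:
  fixes n :: nat and P :: "real mat"
  assumes "n \<ge> 1"
    and "permutation_mat n P"
    and "mat_trace P = 0"
    and "settled P"
    and "strang_canonical P"
  shows "\<exists>Ms :: real mat list.
           length Ms < 2 * bandwidth P \<and>
           (\<forall>M\<in>set Ms. permutation_mat n M \<and> bandwidth_at_most_1 M) \<and>
           P = foldr (*) Ms (1\<^sub>m n)"
proof -
  let ?c = "col_of P" and ?d = "row_of P" and ?w = "bandwidth P"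
  note P = assms(2)
  have n: "dim_row P = n" using P unfolding permutation_mat_def by auto
  have part: "partition_on {..<n} (sections P)"
    and inv: "\<And>I. I \<in> sections P \<Longrightarrow> (\<exists>a b. I = {a..<b}) \<and> ?c ` I = I"
    using sections_invariant_interval_partition[OF P] unfolding invariant_interval_partition_def n by auto
  have sub: "I \<subseteq> {..<n}" if "I \<in> sections P" for I using part that unfolding partition_on_def by auto
  have nofix: "?c i \<noteq> i" if "i < n" for i using col_of_neq_if_trace_0[OF P assms(3) that] .
  have band: "?c i \<le> i + ?w \<and> i \<le> ?c i + ?w" if "i < n" for i using col_of_bandwidth[of i P] that n by simp
  \<comment> \<open>Row 0 exists and is not fixed. Positivity makes the natural number
    \<open>2 * ?w - 1\<close> strictly smaller than \<open>2 * ?w\<close>.\<close>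
  have w: "0 < ?w" using band[of 0] nofix[of 0] assms(1) by auto
  have dc: "?d (?c i) = i" if "i < n" for i using row_of_col_of[OF P that] .
  have bijI: "bij_betw ?c I I" if "I \<in> sections P" for I
    using inv[OF that] inj_on_subset[OF inj_on_col_of[OF P] sub[OF that]] by (auto simp: bij_betw_def)
  have upper: "?c i < ?c j" if "I \<in> sections P" "i \<in> I" "j \<in> I" "i < j" "i < ?c i" "j < ?c j" for I i j
  proof -
    have "?c i \<noteq> ?c j" using bijI[OF that(1)] that by (auto simp: bij_betw_def dest: inj_onD)
    moreover have "\<not> ?c j < ?c i"
      using assms(5) that unfolding strang_canonical_def upper_canonical_def contented_pair_def
        inverted_pair_def positive_row_def by blast
    ultimately show ?thesis by simp
  qed
  have lower: "?c i < ?c j" if "I \<in> sections P" "i \<in> I" "j \<in> I" "i < j" "?c i < i" "?c j < j" for I i j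
  proof -
    have "?c i \<noteq> ?c j" using bijI[OF that(1)] that by (auto simp: bij_betw_def dest: inj_onD)
    moreover have "\<not> ?c j < ?c i"
      using assms(5) that unfolding strang_canonical_def lower_canonical_def contented_pair_def
        inverted_pair_def negative_row_def by blast
    ultimately show ?thesis by simp
  qed
  have "\<exists>p. unit_step_path {..<n} (2 * ?w - 1) ?c p"
  proof (cases "\<forall>I\<in>sections P. row_settled P I")
    case True
    show ?thesis
    proof (rule unit_step_path_partition[OF part])
      fix I assume I: "I \<in> sections P"
      obtain a b where ab: "I = {a..<b}" using inv[OF I] by blast
      have lt: "i < n" if "i \<in> I" for i using sub[OF I] that by auto
      show "\<exists>p. unit_step_path I (2 * ?w - 1) ?c p"
        unfolding ab
      proof (rule row_settled_unit_step_path; (fold ab)?)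
        show "bij_betw ?c I I" using bijI[OF I] .
        show "i < j" if "i \<in> I" "j \<in> I" "i < ?c i" "?c j < j" for i j
          using True I that unfolding row_settled_def positive_row_def negative_row_def by blast
      qed (use nofix band lt upper[OF I] lower[OF I] in blast)+
    qed
  next
    case False
    \<comment> \<open>Negative columns of \<open>P\<close> are exactly the right movers of
      \<open>?d\<close> and positive columns its left movers, so column-settledness of
      \<open>P\<close> is row-settledness of the inverse.\<close>
    then have col: "column_settled P I" if "I \<in> sections P" for I
      using assms(4) that unfolding settled_def by blast
    have "\<exists>q. unit_step_path {..<n} (2 * ?w - 1) ?d q"
    proof (rule unit_step_path_partition[OF part])
      fix I assume I: "I \<in> sections P"
      obtain a b where ab: "I = {a..<b}" using inv[OF I] by blast
      have lt: "i < n" if "i \<in> I" for i using sub[OF I] that by auto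
      have pre: "\<exists>i\<in>I. j = ?c i \<and> ?d j = i" if "j \<in> I" for j
        using inv[OF I] that dc lt by (metis imageE)
      have dI: "?d j \<in> I" "?c (?d j) = j" if "j \<in> I" for j using pre[OF that] by auto
      have bijd: "bij_betw ?d I I"
        by (rule bij_betw_byWitness[where f' = ?c]) (use dI dc lt inv[OF I] in auto)
      show "\<exists>p. unit_step_path I (2 * ?w - 1) ?d p"
        unfolding ab
      proof (rule row_settled_unit_step_path; (fold ab)?)
        show "bij_betw ?d I I" using bijd .
        show "?d j \<noteq> j" if "j \<in> I" for j using nofix[of "?d j"] dI[OF that] lt by metis
        show "i < j" if "i \<in> I" "j \<in> I" "i < ?d i" "?d j < j" for i j
          using col[OF I] that unfolding column_settled_def positive_col_def negative_col_def by blast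
        show "?d j \<le> j + ?w \<and> j \<le> ?d j + ?w" if "j \<in> I" for j
          using band[of "?d j"] dI[OF that] lt by auto
        \<comment> \<open>Inversion exchanges the two canonicity conditions: \<open>i < ?d i\<close>
          makes \<open>?d i\<close> a negative row of \<open>P\<close>. If
          \<open>?d j < ?d i\<close>, then \<open>lower\<close> would give
          \<open>j < i\<close>.\<close>
        show "?d i < ?d j" if h: "i \<in> I" "j \<in> I" "i < j" "i < ?d i" "j < ?d j" for i j
          using lower[OF I, of "?d j" "?d i"] dI[OF h(1)] dI[OF h(2)] h
          by (metis not_less_iff_gr_or_eq)
        show "?d i < ?d j" if h: "i \<in> I" "j \<in> I" "i < j" "?d i < i" "?d j < j" for i j
          using upper[OF I, of "?d j" "?d i"] dI[OF h(1)] dI[OF h(2)] h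
          by (metis not_less_iff_gr_or_eq)
      qed
    qed
    then obtain q where "unit_step_path {..<n} (2 * ?w - 1) ?d q" by blast
    from unit_step_path_inverse[OF this bij_betw_col_of[OF P]] dc show ?thesis by auto
  qed
  then obtain p where "unit_step_path {..<n} (2 * ?w - 1) ?c p" by blast
  from unit_step_path_factorization[OF this] obtain Ms :: "real mat list"
    where "length Ms = 2 * ?w - 1" "\<forall>M\<in>set Ms. permutation_mat n M \<and> bandwidth_at_most_1 M"
      "P = foldr (*) Ms (1\<^sub>m n)"
    unfolding perm_mat_col_of[OF P] by blast
  with w show ?thesis by (intro exI[of _ Ms]) simp
qed

end
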